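(* For any partition into two subsets of a set which contains an infinite arithmetic (respectively geometric) progression, at least one of these two subsets contains an infinite number of triplets such that each triplet is an arithmetic (respectively geometric) progression.
   Context: An infinite arithmetic progression of ratio $r$ is a sequence $a_1, a_2, \dots$ with $a_n = a_1 + (n-1)r$ for $n \ge 1$; an infinite geometric progression of ratio $r$ is a sequence $a_1, a_2, \dots$ with $a_n = a_1 r^{n-1}$ for $n \ge 1$. A set contains such a progression if all of its terms belong to the set. A triplet $(x,y,z)$ is an arithmetic progression if $2y = x+z$, and a geometric progression if $y^2 = xz$. The statement comprises two assertions, one for arithmetic and one for geometric progressions.
   Formalization: The infinite progression is required to have infinitely many distinct terms, since the claim fails for constant or periodic progressions (e.g. the set {0} with ratio 0, or {1,-1} with geometric ratio -1); the triplets found have pairwise distinct entries. *)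

theory Defs
  imports Complex_Main
begin

text \<open>
  The ambient number system is left open: any integral domain of characteristic zero
  (e.g. \<^typ>\<open>int\<close>, \<^typ>\<open>rat\<close>, \<^typ>\<open>real\<close>, \<^typ>\<open>complex\<close>). Sequences are indexed from 1;
  the value at 0 is irrelevant.
\<close>

definition arith_progression :: "'a::{idom,ring_char_0} \<Rightarrow> (nat \<Rightarrow> 'a) \<Rightarrow> bool" where
  "arith_progression r a \<longleftrightarrow> (\<forall>n\<ge>1. a n = a 1 + of_nat (n - 1) * r)"

definition geom_progression :: "'a::{idom,ring_char_0} \<Rightarrow> (nat \<Rightarrow> 'a) \<Rightarrow> bool" where
  "geom_progression r a \<longleftrightarrow> (\<forall>n\<ge>1. a n = a 1 * r ^ (n - 1))"

text \<open>
  An infinite progression is required to have infinitely many distinct terms. Over the reals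
  this excludes exactly ratio 0 in the arithmetic case, and first term 0 or ratio in
  \<open>{-1, 0, 1}\<close> in the geometric case; such a degenerate progression only has finitely many
  terms, and its set of terms contains only finitely many triplets altogether.
\<close>

definition contains_infinite_arith :: "'a::{idom,ring_char_0} set \<Rightarrow> bool" where
  "contains_infinite_arith S \<longleftrightarrow>
     (\<exists>r a. arith_progression r a \<and> infinite (a ` {1..}) \<and> (\<forall>n\<ge>1. a n \<in> S))"

definition contains_infinite_geom :: "'a::{idom,ring_char_0} set \<Rightarrow> bool" where
  "contains_infinite_geom S \<longleftrightarrow>
     (\<exists>r a. geom_progression r a \<and> infinite (a ` {1..}) \<and> (\<forall>n\<ge>1. a n \<in> S))"

definition arith_triplet :: "'a::{idom,ring_char_0} \<Rightarrow> 'a \<Rightarrow> 'a \<Rightarrow> bool" where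
  "arith_triplet x y z \<longleftrightarrow> 2 * y = x + z"

definition geom_triplet :: "'a::{idom,ring_char_0} \<Rightarrow> 'a \<Rightarrow> 'a \<Rightarrow> bool" where
  "geom_triplet x y z \<longleftrightarrow> y\<^sup>2 = x * z"

text \<open>
  Only triplets of pairwise distinct elements are counted: every \<open>(x, x, x)\<close> satisfies
  both equations, so otherwise any infinite set would contain infinitely many triplets.
\<close>

definition arith_triplets_in :: "'a::{idom,ring_char_0} set \<Rightarrow> ('a \<times> 'a \<times> 'a) set" where
  "arith_triplets_in A =
     {(x, y, z). x \<in> A \<and> y \<in> A \<and> z \<in> A \<and> distinct [x, y, z] \<and> arith_triplet x y z}"

definition geom_triplets_in :: "'a::{idom,ring_char_0} set \<Rightarrow> ('a \<times> 'a \<times> 'a) set" where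
  "geom_triplets_in A =
     {(x, y, z). x \<in> A \<and> y \<in> A \<and> z \<in> A \<and> distinct [x, y, z] \<and> geom_triplet x y z}"

end

(* Colour the index n by whether the n-th term lies in A. Any nine consecutive indices contain a
   monochromatic three-term arithmetic progression (the van der Waerden number W(2,3) is 9), so
   monochromatic progressions of indices start arbitrarily far out and one colour has infinitely
   many of them. Both kinds of infinite progression send index progressions to triplets of their
   kind, and injectively so: a progression is the orbit of a single map, hence a repeated term
   would make its range finite. *)

theory Submission
  imports Defs
begin

text \<open>The window \<open>N\<close>, ..., \<open>N + 8\<close> suffices for every
  \<open>N\<close>; leaving \<open>N\<close> free is what later yields infinitely many
  progressions.\<close>

lemma monochromatic_3_term_progression:
  fixes P :: "nat \<Rightarrow> bool"
  shows "\<exists>n\<ge>N. \<exists>d>0. P (n + d) = P n \<and> P (n + 2 * d) = P n"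
proof (rule ccontr)
  assume no_mono: "\<not> ?thesis"
  define Q where "Q k = P (N + k)" for k
  have split: "Q i \<noteq> Q j \<or> Q i \<noteq> Q k" if "i < j" "i + k = 2 * j" for i j k
  proof -
    define d where "d = j - i"
    have "d > 0" "j = i + d" "k = i + 2 * d"
      using that by (auto simp: d_def)
    then show ?thesis
      using no_mono unfolding Q_def by (metis add.assoc le_add1)
  qed
  \<comment> \<open>These are all 16 three-term progressions inside {0, ..., 8}: seven with
    difference 1, five with 2, three with 3, one with 4. No 2-colouring of nine points avoids them
    all, which is a purely propositional fact.\<close>
  have "Q 0 \<noteq> Q 1 \<or> Q 0 \<noteq> Q 2" "Q 1 \<noteq> Q 2 \<or> Q 1 \<noteq> Q 3" "Q 2 \<noteq> Q 3 \<or> Q 2 \<noteq> Q 4"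
    "Q 3 \<noteq> Q 4 \<or> Q 3 \<noteq> Q 5" "Q 4 \<noteq> Q 5 \<or> Q 4 \<noteq> Q 6" "Q 5 \<noteq> Q 6 \<or> Q 5 \<noteq> Q 7"
    "Q 6 \<noteq> Q 7 \<or> Q 6 \<noteq> Q 8" "Q 0 \<noteq> Q 2 \<or> Q 0 \<noteq> Q 4" "Q 1 \<noteq> Q 3 \<or> Q 1 \<noteq> Q 5"
    "Q 2 \<noteq> Q 4 \<or> Q 2 \<noteq> Q 6" "Q 3 \<noteq> Q 5 \<or> Q 3 \<noteq> Q 7" "Q 4 \<noteq> Q 6 \<or> Q 4 \<noteq> Q 8"
    "Q 0 \<noteq> Q 3 \<or> Q 0 \<noteq> Q 6" "Q 1 \<noteq> Q 4 \<or> Q 1 \<noteq> Q 7" "Q 2 \<noteq> Q 5 \<or> Q 2 \<noteq> Q 8"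
    "Q 0 \<noteq> Q 4 \<or> Q 0 \<noteq> Q 8"
    by (rule split; simp)+
  then show False
    by sat
qed

text \<open>Once a value recurs, the orbit is periodic from there on, so the values before the
  recurrence exhaust it.\<close>

lemma inj_funpow_orbit:
  fixes h :: "'a \<Rightarrow> 'a"
  assumes "infinite (range (\<lambda>n. (h ^^ n) x))"
  shows "inj (\<lambda>n. (h ^^ n) x)"
proof (rule linorder_injI)
  fix i j :: nat
  assume "i < j"
  show "(h ^^ i) x \<noteq> (h ^^ j) x"
  proof
    assume eq: "(h ^^ i) x = (h ^^ j) x"
    have "(h ^^ n) x \<in> (\<lambda>n. (h ^^ n) x) ` {..<j}" for n
    proof (induction n rule: less_induct)
      case (less n)
      show ?case
      proof (cases "n < j")
        case False
        then obtain k where k: "n = k + j"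
          by (metis add.commute le_add_diff_inverse not_less)
        \<comment> \<open>Replacing the last \<open>j\<close> steps by \<open>i\<close> steps gives
          the same value at the smaller index \<open>k + i\<close>, to which the induction
          hypothesis applies.\<close>
        have "(h ^^ n) x = (h ^^ (k + i)) x"
          by (simp only: k funpow_add comp_apply eq)
        then show ?thesis
          using less.IH[of "k + i"] \<open>i < j\<close> k by simp
      qed simp
    qed
    then have "range (\<lambda>n. (h ^^ n) x) \<subseteq> (\<lambda>n. (h ^^ n) x) ` {..<j}"
      by blast
    with assms show False
      using finite_subset by blast
  qed
qed

text \<open>The relation \<open>R\<close> is kept abstract so that one argument serves both kinds of
  triplet.\<close>

lemma infinite_monochromatic_triplets:
  fixes f :: "nat \<Rightarrow> 'a"
  assumes "inj f" and "range f \<subseteq> A \<union> B"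
    and triplet: "\<And>n d. R (f n) (f (n + d)) (f (n + 2 * d))"
  defines "T \<equiv> \<lambda>C. {(x, y, z). x \<in> C \<and> y \<in> C \<and> z \<in> C \<and> distinct [x, y, z] \<and> R x y z}"
  shows "infinite (T A) \<or> infinite (T B)"
proof -
  define g where "g = (\<lambda>(n, d). (f n, f (n + d), f (n + 2 * d)))"
  define M where "M = {(n, d). d > 0 \<and> g (n, d) \<in> T A \<union> T B}"
  have "\<exists>n\<ge>N. n \<in> fst ` M" for N
  proof -
    obtain n d where nd: "n \<ge> N" "d > 0"
      and mono: "(f (n + d) \<in> A) = (f n \<in> A)" "(f (n + 2 * d) \<in> A) = (f n \<in> A)"
      using monochromatic_3_term_progression[of N "\<lambda>n. f n \<in> A"] by blast
    have "distinct [f n, f (n + d), f (n + 2 * d)]"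
      using \<open>inj f\<close> \<open>d > 0\<close> by (simp add: inj_eq)
    \<comment> \<open>If the common colour is "not in \<open>A\<close>", the cover puts all three
      terms in \<open>B\<close>.\<close>
    moreover have "f k \<in> A \<or> f k \<in> B" for k
      using assms(2) by blast
    ultimately have "g (n, d) \<in> T A \<union> T B"
      using mono triplet[of n d] by (auto simp: g_def T_def)
    then have "(n, d) \<in> M"
      using nd by (simp add: M_def)
    then show ?thesis
      using nd by force
  qed
  then have "infinite (fst ` M)"
    unfolding finite_nat_set_iff_bounded by (meson not_less)
  then have "infinite M"
    by blast
  \<comment> \<open>The first entry of the triplet determines \<open>n\<close>, and the second then
    determines \<open>d\<close>.\<close>
  moreover have "inj g"
    using \<open>inj f\<close> by (auto intro!: injI simp: g_def inj_eq)
  ultimately have "infinite (g ` M)"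
    by (metis finite_imageD inj_on_subset subset_UNIV)
  moreover have "g ` M \<subseteq> T A \<union> T B"
    by (auto simp: M_def)
  ultimately show ?thesis
    by (meson finite_UnI finite_subset)
qed

lemma range_shift_from_1: "range (\<lambda>n. a (Suc n)) = a ` {1..}"
proof -
  have "range Suc = {1..}"
    by (auto simp: image_iff Suc_le_eq gr0_conv_Suc)
  then show ?thesis
    by (metis image_image)
qed

theorem mainTheorem1:
  fixes S A B :: "'a::{idom,ring_char_0} set"
  assumes "A \<union> B = S" and "A \<inter> B = {}"
  shows "(contains_infinite_arith S \<longrightarrow>
            infinite (arith_triplets_in A) \<or> infinite (arith_triplets_in B)) \<and>
         (contains_infinite_geom S \<longrightarrow>
            infinite (geom_triplets_in A) \<or> infinite (geom_triplets_in B))"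
proof (intro conjI impI)
  assume "contains_infinite_arith S"
  then obtain r a where a: "arith_progression r a" "infinite (a ` {1..})" "\<forall>n\<ge>1. a n \<in> S"
    unfolding contains_infinite_arith_def by blast
  \<comment> \<open>Reindexing from 0 makes \<open>f n\<close> the \<open>n\<close>-th iterate
    applied to the first term.\<close>
  define f where "f n = a (Suc n)" for n
  have f: "f n = a 1 + of_nat n * r" for n
    using a(1)[unfolded arith_progression_def, rule_format, of "Suc n"] by (simp add: f_def)
  have orbit: "f = (\<lambda>n. ((\<lambda>x. x + r) ^^ n) (a 1))"
  proof
    show "f n = ((\<lambda>x. x + r) ^^ n) (a 1)" for n
      unfolding f by (induction n) (simp_all add: algebra_simps)
  qed
  have "infinite (range f)"
    using a(2) by (simp add: f_def range_shift_from_1)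
  then have "inj f"
    unfolding orbit by (rule inj_funpow_orbit)
  moreover have "range f \<subseteq> A \<union> B"
    using a(3) assms(1) by (auto simp: f_def)
  moreover have "arith_triplet (f n) (f (n + d)) (f (n + 2 * d))" for n d
    by (simp add: arith_triplet_def f algebra_simps)
  ultimately show "infinite (arith_triplets_in A) \<or> infinite (arith_triplets_in B)"
    unfolding arith_triplets_in_def by (rule infinite_monochromatic_triplets)
next
  assume "contains_infinite_geom S"
  then obtain r a where a: "geom_progression r a" "infinite (a ` {1..})" "\<forall>n\<ge>1. a n \<in> S"
    unfolding contains_infinite_geom_def by blast
  define f where "f n = a (Suc n)" for n
  have f: "f n = a 1 * r ^ n" for n
    using a(1)[unfolded geom_progression_def, rule_format, of "Suc n"] by (simp add: f_def)
  \<comment> \<open>The orbit view avoids a case split on \<open>r\<close>: the infinite range rules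
    out a zero first term, a zero ratio and roots of unity all at once.\<close>
  have orbit: "f = (\<lambda>n. ((\<lambda>x. x * r) ^^ n) (a 1))"
  proof
    show "f n = ((\<lambda>x. x * r) ^^ n) (a 1)" for n
      unfolding f by (induction n) (simp_all add: algebra_simps)
  qed
  have "infinite (range f)"
    using a(2) by (simp add: f_def range_shift_from_1)
  then have "inj f"
    unfolding orbit by (rule inj_funpow_orbit)
  moreover have "range f \<subseteq> A \<union> B"
    using a(3) assms(1) by (auto simp: f_def)
  \<comment> \<open>Both sides equal \<open>(a 1)^2 * r^(2 * n + 2 * d)\<close>.\<close>
  moreover have "geom_triplet (f n) (f (n + d)) (f (n + 2 * d))" for n d
    by (simp add: geom_triplet_def f power_add power_mult power2_eq_square power_mult_distrib
        algebra_simps)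
  ultimately show "infinite (geom_triplets_in A) \<or> infinite (geom_triplets_in B)"
    unfolding geom_triplets_in_def by (rule infinite_monochromatic_triplets)
qed

end
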